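(* Let $G$ be a graph of order $n$. If $G$ contains an induced star $K_{1,t}$ with $t\ge 3$, then $\operatorname{st}_{\gamma_{st}}(G)\le n-t+1$.
   Context: All graphs are finite, simple and undirected. For a graph $G=(V,E)$, a set $D\subseteq V$ is a strong dominating set if every vertex $v\in V\setminus D$ is adjacent to some $u\in D$ with $\deg(v)\le\deg(u)$ (degrees taken in $G$). The strong domination number $\gamma_{st}(G)$ is the minimum size of a strong dominating set. For $S\subseteq V$, $G-S$ is the graph obtained by deleting the vertices of $S$. The stability of the strong domination number is $\operatorname{st}_{\gamma_{st}}(G)=\min\{|S| : S\subseteq V,\ \gamma_{st}(G-S)\ne\gamma_{st}(G)\}$. *)

theory Defs
  imports "Graph_Theory.Kuratowski"
begin

text \<open>
  Finite simple undirected graphs are the symmetric digraphs of locale \<^locale>\<open>graph\<close>. Every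
  edge is a pair of opposite arcs, so the degree of a vertex is its \<^const>\<open>out_degree\<close>.
\<close>

definition strong_dominating_set :: "('a, 'b) pre_digraph \<Rightarrow> 'a set \<Rightarrow> bool" where
  "strong_dominating_set G D \<longleftrightarrow>
     D \<subseteq> verts G \<and>
     (\<forall>v \<in> verts G - D. \<exists>u \<in> D. u \<rightarrow>\<^bsub>G\<^esub> v \<and> out_degree G v \<le> out_degree G u)"

text \<open>
  For a finite graph this is the minimum of a finite nonempty set, since \<^term>\<open>verts G\<close> is itself
  strong dominating. The null graph has strong domination number 0.
\<close>

definition strong_domination_number :: "('a, 'b) pre_digraph \<Rightarrow> nat" where
  "strong_domination_number G = Min {card D | D. strong_dominating_set G D}"

definition delete_verts :: "('a, 'b) pre_digraph \<Rightarrow> 'a set \<Rightarrow> ('a, 'b) pre_digraph" where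
  "delete_verts G S = G \<restriction> (verts G - S)"

text \<open>
  All of \<^term>\<open>verts G\<close> may be deleted, leaving the null graph; hence for a finite graph with at
  least one vertex the set below is nonempty. The value is unspecified for the null graph.
\<close>

definition strong_domination_stability :: "('a, 'b) pre_digraph \<Rightarrow> nat" where
  "strong_domination_stability G =
     Min {card S | S. S \<subseteq> verts G \<and>
       strong_domination_number (delete_verts G S) \<noteq> strong_domination_number G}"

end

theory Submission
  imports Defs
begin

text \<open>
  The induced star has strong domination number 1, whereas its \<open>t\<close> leaves alone induce an arcless
  graph, with strong domination number \<open>t\<close>. One of the two numbers differs from that of \<open>G\<close>, and
  either graph is obtained from \<open>G\<close> by deleting at most \<open>n - t\<close> vertices.
\<close>

lemma strong_domination_number_le:
  assumes "finite (verts G)" and "strong_dominating_set G D"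
  shows "strong_domination_number G \<le> card D"
proof -
  have "{card D | D. strong_dominating_set G D} \<subseteq> card ` Pow (verts G)"
    by (auto simp: strong_dominating_set_def)
  then have "finite {card D | D. strong_dominating_set G D}"
    using assms(1) by (meson finite_Pow_iff finite_imageI finite_subset)
  then show ?thesis
    unfolding strong_domination_number_def using assms(2) by (intro Min_le) auto
qed

text \<open>With no arcs, a vertex outside \<open>D\<close> has no neighbour to dominate it, so the
  whole vertex set is the only candidate.\<close>

lemma strong_domination_number_arcless:
  assumes "arcs G = {}"
  shows "strong_domination_number G = card (verts G)"
proof -
  have "strong_dominating_set G D \<longleftrightarrow> D = verts G" for D
    using assms by (auto simp: strong_dominating_set_def arcs_ends_def)
  then show ?thesis
    by (simp add: strong_domination_number_def)
qed

lemma strong_domination_stability_le: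
  assumes "finite (verts G)" and "S \<subseteq> verts G"
    and "strong_domination_number (delete_verts G S) \<noteq> strong_domination_number G"
  shows "strong_domination_stability G \<le> card S"
proof -
  let ?C = "{card S | S. S \<subseteq> verts G \<and>
    strong_domination_number (delete_verts G S) \<noteq> strong_domination_number G}"
  have "?C \<subseteq> card ` Pow (verts G)"
    by auto
  then have "finite ?C"
    using assms(1) by (meson finite_Pow_iff finite_imageI finite_subset)
  then show ?thesis
    unfolding strong_domination_stability_def using assms(2,3) by (intro Min_le) auto
qed

text \<open>The absence of parallel arcs makes \<open>head G\<close> injective on the arcs leaving
  \<open>v\<close>. Degrees can then be read off \<open>arcs_ends\<close>, through which the star is
  specified.\<close>

lemma (in nomulti_digraph) out_degree_eq_card:
  "out_degree G v = card {w. v \<rightarrow>\<^bsub>G\<^esub> w}"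
proof -
  have "bij_betw (head G) (out_arcs G v) {w. v \<rightarrow>\<^bsub>G\<^esub> w}"
    unfolding bij_betw_def
  proof
    show "inj_on (head G) (out_arcs G v)"
      by (intro inj_onI no_multi_arcs) (auto simp: arc_to_ends_def)
    show "head G ` out_arcs G v = {w. v \<rightarrow>\<^bsub>G\<^esub> w}"
      by (auto simp: arcs_ends_def arc_to_ends_def)
  qed
  then show ?thesis
    unfolding out_degree_def by (rule bij_betw_same_card)
qed

lemma delete_verts_compl:
  assumes "W \<subseteq> verts G"
  shows "delete_verts G (verts G - W) = G \<restriction> W"
  using assms by (simp add: delete_verts_def double_diff)

text \<open>Compatibility makes the tail and head maps of \<open>H\<close> those of
  \<open>G\<close>, so the two agree as records and not merely up to isomorphism.\<close>

lemma induced_subgraph_eq_induce: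
  assumes "induced_subgraph H G"
  shows "H = G \<restriction> verts H"
  using assms
  by (simp add: induced_subgraph_def subgraph_def compatible_def induce_subgraph_def)

text \<open>The centre alone suffices: it is adjacent to every leaf, and its degree \<open>t\<close>
  is at least the degree 1 of a leaf.\<close>

lemma strong_domination_number_star:
  assumes "complete_bipartite_digraph 1 t H" and "t \<ge> 1"
  shows "strong_domination_number H \<le> 1"
proof -
  from assms(1) interpret graph H
    by (simp add: complete_bipartite_digraph_def)
  from assms(1) obtain c V where V: "verts H = {c} \<union> V" "c \<notin> V" "card V = t"
    and ends: "arcs_ends H = {c} \<times> V \<union> V \<times> {c}"
    by (auto simp: complete_bipartite_digraph_def card_1_singleton_iff)
  have "{w. c \<rightarrow>\<^bsub>H\<^esub> w} = V" and "v \<in> V \<Longrightarrow> {w. v \<rightarrow>\<^bsub>H\<^esub> w} = {c}" for v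
    using V(2) by (auto simp: ends)
  then have "strong_dominating_set H {c}"
    using V assms(2) by (auto simp: strong_dominating_set_def out_degree_eq_card ends)
  then show ?thesis
    using strong_domination_number_le[OF finite_verts] by fastforce
qed

theorem theorem3p4:
  fixes G :: "('a, 'b) pre_digraph" and n t :: nat
  assumes "graph G"
    and "card (verts G) = n"
    and "t \<ge> 3"
    and "\<exists>H. induced_subgraph H G \<and> complete_bipartite_digraph 1 t H"
  shows "int (strong_domination_stability G) \<le> int n - int t + 1"
proof -
  from assms(1) interpret graph G .
  from assms(4) obtain H where ind: "induced_subgraph H G"
    and star: "complete_bipartite_digraph 1 t H"
    by blast
  from star obtain c V where H: "verts H = {c} \<union> V" "c \<notin> V" "card V = t"
    and ends: "arcs_ends H = {c} \<times> V \<union> V \<times> {c}"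
    by (auto simp: complete_bipartite_digraph_def card_1_singleton_iff)
  have sub: "verts H \<subseteq> verts G"
    using ind by (simp add: induced_subgraph_def subgraph_def)
  have H_eq: "H = G \<restriction> verts H"
    using ind by (rule induced_subgraph_eq_induce)
  \<comment> \<open>Since \<open>H\<close> is induced, an arc of \<open>G\<close> between two leaves
    would be an arc of \<open>H\<close>; but every arc of the star has the centre \<open>c\<close>
    as an end.\<close>
  have "(tail G e, head G e) \<in> arcs_ends H"
    if "e \<in> arcs G" "tail G e \<in> V" "head G e \<in> V" for e
    by (subst H_eq) (use that H(1) in \<open>auto simp: arcs_ends_def arc_to_ends_def\<close>)
  then have "arcs (G \<restriction> V) = {}"
    using H(2) by (auto simp: ends)
  then have leaves: "strong_domination_number (G \<restriction> V) = t"
    by (simp add: strong_domination_number_arcless H(3))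
  have "strong_domination_number (G \<restriction> verts H) \<le> 1"
    unfolding H_eq[symmetric] using strong_domination_number_star[OF star] assms(3) by simp
  with leaves assms(3) consider
      "strong_domination_number (G \<restriction> verts H) \<noteq> strong_domination_number G"
    | "strong_domination_number (G \<restriction> V) \<noteq> strong_domination_number G"
    by linarith
  \<comment> \<open>\<open>W\<close> is the set of vertices kept, either \<open>verts H\<close> or
    \<open>V\<close>. Both contain the \<open>t\<close> leaves, which is all that the count below
    needs.\<close>
  then obtain W where W: "V \<subseteq> W" "W \<subseteq> verts G"
    and neq: "strong_domination_number (G \<restriction> W) \<noteq> strong_domination_number G"
    using sub H(1) by (metis Un_upper2 order.refl order.trans)
  have "finite W"
    using W(2) finite_verts by (rule finite_subset)
  have "strong_domination_stability G \<le> card (verts G - W)"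
    using neq W(2) by (intro strong_domination_stability_le) (simp_all add: delete_verts_compl)
  \<comment> \<open>The bound \<open>card W \<le> n\<close> ensures that the subtraction on naturals
    is not truncated, so it agrees with the one on integers in the goal.\<close>
  moreover have "card (verts G - W) = n - card W" "card W \<le> n"
    using W(2) \<open>finite W\<close> assms(2) by (auto simp: card_Diff_subset intro: card_mono)
  moreover have "t \<le> card W"
    using card_mono[OF \<open>finite W\<close> W(1)] H(3) by simp
  ultimately show ?thesis
    by linarith
qed

end
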